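(* Let $\alpha: I\to E_1^3$ be a non-lightlike curve and let $\beta$ be a non-lightlike Bertrand-direction curve of $\alpha$. If $\alpha$ is a plane curve, then $\beta$ is a helix. Similarly, if $\beta$ is a plane curve, then $\alpha$ is a helix.
   Context: $E_1^3$ is $\mathbb{R}^3$ with the metric $\langle x,y\rangle=-x_1y_1+x_2y_2+x_3y_3$ and the Lorentz vector product $x\times y=(x_2y_3-x_3y_2,\ x_1y_3-x_3y_1,\ x_2y_1-x_1y_2)$. A vector $x$ is spacelike if $\langle x,x\rangle>0$ or $x=0$, timelike if $\langle x,x\rangle<0$, lightlike if $\langle x,x\rangle=0$ and $x\ne0$. A curve is timelike (spacelike) if all its velocity vectors are; non-lightlike means timelike or spacelike; unit speed means $|\langle\alpha',\alpha'\rangle|=1$. All curves are unit speed Frenet curves, as differentiable as needed. A unit speed non-lightlike curve $\alpha(s)$ has Frenet frame $\{T,N,B\}$ (orthonormal, non-lightlike vectors, $T=\alpha'$), curvature $\kappa$ and torsion $\tau$ with $T'=\kappa N,\ N'=\varepsilon_B\kappa T+\tau B,\ B'=\varepsilon_T\tau N$, where $\varepsilon_Y=\langle Y,Y\rangle=\pm1$ and $\varepsilon_B=-\varepsilon_T\varepsilon_N$; the frame satisfies $B=\varepsilon_T\varepsilon_N T\times N$, $N=\varepsilon_B\varepsilon_T B\times T$, $T=\varepsilon_N\varepsilon_B N\times B$. It is a Frenet curve if $\kappa\neq0$. A spacelike curve is of type 1 if $N$ is timelike (and $T,B$ spacelike), of type 2 if $B$ is timelike (and $T,N$ spacelike). Let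 $X=uT+vN+wB$ with $u,v,w$ differentiable and $\varepsilon_Tu^2+\varepsilon_Nv^2+\varepsilon_Bw^2=\pm1$ (constant sign). An $X$-direction curve of $\alpha$ is a curve $\beta$ with tangent $\overline T=X$; $s$ is also arc-length for $\beta$. The Frenet frame, curvature and torsion of $\beta$ are $\{\overline T,\overline N,\overline B\},\overline\kappa,\overline\tau$, with $\overline\kappa\ne0$. $\beta$ is a Bertrand-direction curve of $\alpha$ if it is an $X$-direction curve of $\alpha$ and a Bertrand curve of $\alpha$ with $\alpha$ its Bertrand partner curve (i.e. $\overline N=N$); explicitly, for a constant $\theta$, $X$ is: $\cosh\theta\,T+\sinh\theta\,B$ if $\alpha$ is timelike (resp. spacelike of type 2) and $X$ timelike (resp. spacelike); $\sinh\theta\,T+\cosh\theta\,B$ if $\alpha$ is timelike (resp. spacelike of type 2) and $X$ spacelike (resp. timelike); $\cos\theta\,T+\sin\theta\,B$ if $\alpha$ is spacelike of type 1 and $X$ spacelike. A (general) helix is a curve for which the ratio of its non-zero curvature to its non-zero torsion is a constant function. A plane curve is a curve lying in a plane (equivalently here, its torsion vanishes identically).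
   Formalization: The degenerate case in which the tangent of β is everywhere T or everywhere −T is excluded: there β is a (reflected) translate of α, so if α is a plane curve then β has zero torsion and is not a helix. *)

theory Defs
  imports "HOL-Analysis.Analysis"
begin

definition lor :: "real^3 \<Rightarrow> real^3 \<Rightarrow> real" where
  "lor x y = - (x$1 * y$1) + x$2 * y$2 + x$3 * y$3"

definition lor_cross :: "real^3 \<Rightarrow> real^3 \<Rightarrow> real^3" where
  "lor_cross x y = vector [x$2 * y$3 - x$3 * y$2, x$1 * y$3 - x$3 * y$1, x$2 * y$1 - x$1 * y$2]"

definition spacelike :: "real^3 \<Rightarrow> bool" where
  "spacelike x \<longleftrightarrow> lor x x > 0 \<or> x = 0"

definition timelike :: "real^3 \<Rightarrow> bool" where
  "timelike x \<longleftrightarrow> lor x x < 0"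

text \<open>A curve is a map \<open>real \<Rightarrow> real^3\<close> of which only the values on the parameter interval matter;
  derivatives are taken within the interval, hence one-sided at an end point that belongs to it.
  The interval must have more than one point for these derivatives to be meaningful.\<close>

definition param_interval :: "real set \<Rightarrow> bool" where
  "param_interval I \<longleftrightarrow> is_interval I \<and> interior I \<noteq> {}"

definition timelike_curve :: "real set \<Rightarrow> (real \<Rightarrow> real^3) \<Rightarrow> bool" where
  "timelike_curve I \<alpha> \<longleftrightarrow> (\<forall>s\<in>I. timelike (vector_derivative \<alpha> (at s within I)))"

definition spacelike_curve :: "real set \<Rightarrow> (real \<Rightarrow> real^3) \<Rightarrow> bool" where
  "spacelike_curve I \<alpha> \<longleftrightarrow> (\<forall>s\<in>I. spacelike (vector_derivative \<alpha> (at s within I)))"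

definition nonlightlike_curve :: "real set \<Rightarrow> (real \<Rightarrow> real^3) \<Rightarrow> bool" where
  "nonlightlike_curve I \<alpha> \<longleftrightarrow> timelike_curve I \<alpha> \<or> spacelike_curve I \<alpha>"

definition unit_speed :: "real set \<Rightarrow> (real \<Rightarrow> real^3) \<Rightarrow> bool" where
  "unit_speed I \<alpha> \<longleftrightarrow>
     (\<forall>s\<in>I. \<bar>lor (vector_derivative \<alpha> (at s within I)) (vector_derivative \<alpha> (at s within I))\<bar> = 1)"

definition lor_orthonormal :: "real^3 \<Rightarrow> real^3 \<Rightarrow> real^3 \<Rightarrow> bool" where
  "lor_orthonormal t n b \<longleftrightarrow>
     \<bar>lor t t\<bar> = 1 \<and> \<bar>lor n n\<bar> = 1 \<and> \<bar>lor b b\<bar> = 1 \<and>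
     lor t n = 0 \<and> lor t b = 0 \<and> lor n b = 0"

text \<open>\<open>\<alpha>\<close> is a non-lightlike unit speed Frenet curve on \<open>I\<close> with Frenet frame \<open>T, N, B\<close>,
  curvature \<open>\<kappa>\<close> and torsion \<open>\<tau>\<close>. The signs \<open>\<epsilon>\<^sub>Y\<close> of the Frenet equations are written as
  \<open>lor (Y s) (Y s)\<close>. As in the usual pseudo-Riemannian formulation, \<open>\<kappa>\<close> is only required
  to be non-zero, so the pair \<open>N, B\<close> is determined up to a common sign.\<close>

definition frenet_curve ::
  "real set \<Rightarrow> (real \<Rightarrow> real^3) \<Rightarrow> (real \<Rightarrow> real^3) \<Rightarrow> (real \<Rightarrow> real^3) \<Rightarrow> (real \<Rightarrow> real^3)
    \<Rightarrow> (real \<Rightarrow> real) \<Rightarrow> (real \<Rightarrow> real) \<Rightarrow> bool" where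
  "frenet_curve I \<alpha> T N B \<kappa> \<tau> \<longleftrightarrow>
     param_interval I \<and> nonlightlike_curve I \<alpha> \<and> unit_speed I \<alpha> \<and>
     (\<forall>s\<in>I.
        (\<alpha> has_vector_derivative T s) (at s within I) \<and>
        lor_orthonormal (T s) (N s) (B s) \<and>
        lor (B s) (B s) = - (lor (T s) (T s) * lor (N s) (N s)) \<and>
        B s = (lor (T s) (T s) * lor (N s) (N s)) *\<^sub>R lor_cross (T s) (N s) \<and>
        N s = (lor (B s) (B s) * lor (T s) (T s)) *\<^sub>R lor_cross (B s) (T s) \<and>
        T s = (lor (N s) (N s) * lor (B s) (B s)) *\<^sub>R lor_cross (N s) (B s) \<and>
        \<kappa> s \<noteq> 0 \<and>
        (T has_vector_derivative \<kappa> s *\<^sub>R N s) (at s within I) \<and>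
        (N has_vector_derivative (lor (B s) (B s) * \<kappa> s) *\<^sub>R T s + \<tau> s *\<^sub>R B s) (at s within I) \<and>
        (B has_vector_derivative (lor (T s) (T s) * \<tau> s) *\<^sub>R N s) (at s within I))"

text \<open>A curve with tangent \<open>Tb\<close> is an \<open>X\<close>-direction curve of the curve with frame \<open>T, N, B\<close>.\<close>

definition direction_curve ::
  "real set \<Rightarrow> (real \<Rightarrow> real^3) \<Rightarrow> (real \<Rightarrow> real^3) \<Rightarrow> (real \<Rightarrow> real^3)
    \<Rightarrow> (real \<Rightarrow> real^3) \<Rightarrow> (real \<Rightarrow> real^3) \<Rightarrow> bool" where
  "direction_curve I T N B X Tb \<longleftrightarrow>
     (\<exists>u v w. u differentiable_on I \<and> v differentiable_on I \<and> w differentiable_on I \<and>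
        (\<forall>s\<in>I. X s = u s *\<^sub>R T s + v s *\<^sub>R N s + w s *\<^sub>R B s) \<and>
        (\<exists>\<delta>\<in>{-1, 1}. \<forall>s\<in>I.
           lor (T s) (T s) * (u s)\<^sup>2 + lor (N s) (N s) * (v s)\<^sup>2 + lor (B s) (B s) * (w s)\<^sup>2 = \<delta>)) \<and>
     (\<forall>s\<in>I. Tb s = X s)"

text \<open>The condition \<open>Nb = N\<close> forces the component of \<open>X\<close> along \<open>N\<close> to vanish and the components
  along \<open>T\<close> and \<open>B\<close> to be constant, i.e. \<open>X\<close> is, up to signs, \<open>cosh \<theta> T + sinh \<theta> B\<close>,
  \<open>sinh \<theta> T + cosh \<theta> B\<close> or \<open>cos \<theta> T + sin \<theta> B\<close> according to the causal characters.\<close>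

definition bertrand_direction_curve ::
  "real set \<Rightarrow> (real \<Rightarrow> real^3) \<Rightarrow> (real \<Rightarrow> real^3) \<Rightarrow> (real \<Rightarrow> real^3)
    \<Rightarrow> (real \<Rightarrow> real^3) \<Rightarrow> (real \<Rightarrow> real^3) \<Rightarrow> bool" where
  "bertrand_direction_curve I T N B Tb Nb \<longleftrightarrow>
     (\<exists>X. direction_curve I T N B X Tb) \<and> (\<forall>s\<in>I. Nb s = N s)"

text \<open>Affine planes do not depend on the metric, so the normal is taken with respect to the
  Euclidean inner product.\<close>

definition plane_curve :: "real set \<Rightarrow> (real \<Rightarrow> real^3) \<Rightarrow> bool" where
  "plane_curve I \<alpha> \<longleftrightarrow> (\<exists>n c. n \<noteq> 0 \<and> \<alpha> ` I \<subseteq> {x. n \<bullet> x = c})"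

text \<open>The helix condition on the curvature \<open>\<kappa>\<close> and torsion \<open>\<tau>\<close> of a curve; the explicit
  \<open>\<tau> s \<noteq> 0\<close> is essential, since \<open>\<kappa> s / 0 = 0\<close> would make every plane curve a helix.\<close>

definition helix :: "real set \<Rightarrow> (real \<Rightarrow> real) \<Rightarrow> (real \<Rightarrow> real) \<Rightarrow> bool" where
  "helix I \<kappa> \<tau> \<longleftrightarrow>
     (\<forall>s\<in>I. \<kappa> s \<noteq> 0 \<and> \<tau> s \<noteq> 0) \<and> (\<lambda>s. \<kappa> s / \<tau> s) constant_on I"

end

theory Submission
  imports Defs
begin

text \<open>
  Since \<open>Nb = N\<close> is orthogonal to both tangents and both binormals, the products \<open>c = lor T Tb\<close> and
  \<open>d = lor T Bb\<close> have derivative zero and hence are constant. If \<open>\<alpha>\<close> is plane, then \<open>\<tau> = 0\<close>, and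
  pairing the two Frenet expressions for \<open>N' = Nb'\<close> with \<open>Tb\<close> and \<open>Bb\<close> shows that, up to constant
  signs, \<open>\<kappa>b\<close> and \<open>\<tau>b\<close> are \<open>c \<kappa>\<close> and \<open>d \<kappa>\<close>. So \<open>\<beta>\<close> is a helix as soon as \<open>d \<noteq> 0\<close>, which holds
  because the tangents are not everywhere parallel. The other half is the same statement with the
  roles of the curves exchanged; by the triple product identity its constant \<open>lor Tb B\<close> agrees with
  \<open>d\<close> up to sign.
\<close>

lemma bounded_bilinear_lor: "bounded_bilinear lor"
proof -
  have "bilinear lor"
    by (auto simp: bilinear_def lor_def intro!: linearI) (auto simp: algebra_simps)
  then show ?thesis
    by (simp add: bilinear_conv_bounded_bilinear)
qed

interpretation lor: bounded_bilinear lor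
  by (rule bounded_bilinear_lor)

lemma lor_commute: "lor x y = lor y x"
  by (simp add: lor_def)

text \<open>Up to sign, \<open>lor x (lor_cross y z)\<close> is the determinant of the three
  vectors, hence alternating.\<close>

lemma lor_cross_triple: "lor x (lor_cross y z) = - lor y (lor_cross x z)"
  by (simp add: lor_def lor_cross_def algebra_simps)

text \<open>A connected set with more than one point has no isolated point; this makes derivatives
  within \<open>I\<close> unique, also at end points.\<close>

lemma at_within_param_interval_neq_bot:
  assumes "param_interval I" "s \<in> I"
  shows "at s within I \<noteq> bot"
proof -
  have "I \<noteq> {s}"
    using assms(1) by (auto simp: param_interval_def)
  moreover have "connected I"
    using assms(1) by (simp add: param_interval_def is_interval_connected)
  ultimately have "s islimpt I"
    using assms(2) connected_imp_perfect by blast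
  then show ?thesis
    by (simp add: trivial_limit_within)
qed

lemma has_vector_derivative_unique_on_param_interval:
  assumes "param_interval I" "s \<in> I"
    and "(f has_vector_derivative f') (at s within I)"
    and "(g has_vector_derivative g') (at s within I)"
    and "\<And>t. t \<in> I \<Longrightarrow> f t = g t"
  shows "f' = g'"
proof -
  have "(f has_vector_derivative g') (at s within I)"
    using has_vector_derivative_transform[OF assms(2) _ assms(4), of f] assms(5) by simp
  then show ?thesis
    using vector_derivative_unique_within at_within_param_interval_neq_bot assms(1-3) by blast
qed

text \<open>Euclidean orthogonality to \<open>t\<close> and \<open>n\<close> makes \<open>m\<close>
  parallel to their Euclidean cross product, which is \<open>x = lor_cross t n\<close> with its last
  two coordinates negated. The Euclidean product of that vector with \<open>x\<close> is
  \<open>- lor x x\<close>, which is non-zero, so orthogonality to \<open>b\<close> leaves only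
  \<open>m = 0\<close>.\<close>

lemma eq_0_if_orthogonal_to_frame:
  fixes m t n b :: "real^3"
  assumes "b = c *\<^sub>R lor_cross t n" "lor b b \<noteq> 0"
    and "m \<bullet> t = 0" "m \<bullet> n = 0" "m \<bullet> b = 0"
  shows "m = 0"
proof -
  define x where "x = lor_cross t n"
  have x: "x$1 = t$2 * n$3 - t$3 * n$2" "x$2 = t$1 * n$3 - t$3 * n$1" "x$3 = t$2 * n$1 - t$1 * n$2"
    by (simp_all add: x_def lor_cross_def)
  have nz: "c \<noteq> 0" "lor x x \<noteq> 0"
    using assms(1,2) by (auto simp: x_def lor.scaleR_left lor.scaleR_right)
  have mt: "m$1 * t$1 + m$2 * t$2 + m$3 * t$3 = 0" and mn: "m$1 * n$1 + m$2 * n$2 + m$3 * n$3 = 0"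
    using assms(3,4) by (simp_all add: inner_vec_def sum_3)
  have "m \<bullet> x = 0"
    using assms(1,5) nz(1) by (simp add: x_def)
  then have mx: "m$1 * x$1 + m$2 * x$2 + m$3 * x$3 = 0"
    by (simp add: inner_vec_def sum_3)
  \<comment> \<open>Proportionality of \<open>m\<close> to \<open>(x$1, - x$2, - x$3)\<close>
    without division: each equation eliminates one coordinate of \<open>m\<close> from
    \<open>mt\<close> and \<open>mn\<close>.\<close>
  have "m$2 * x$1 = - m$1 * x$2" "m$3 * x$1 = - m$1 * x$3" "m$3 * x$2 = m$2 * x$3"
    using arg_cong2[OF mt mn, of "\<lambda>p q. n$3 * p - t$3 * q"]
      arg_cong2[OF mt mn, of "\<lambda>p q. t$2 * q - n$2 * p"]
      arg_cong2[OF mt mn, of "\<lambda>p q. t$1 * q - n$1 * p"]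
    by (simp_all add: x algebra_simps)
  then have "lor x x * m$1 = 0" "lor x x * m$2 = 0" "lor x x * m$3 = 0"
    unfolding lor_def using mx by algebra+
  then show ?thesis
    using nz(2) by (simp add: vec_eq_iff forall_3)
qed

lemma frenet_curveD:
  assumes "frenet_curve I \<alpha> T N B \<kappa> \<tau>" "s \<in> I"
  shows "(\<alpha> has_vector_derivative T s) (at s within I)"
    and "(T has_vector_derivative \<kappa> s *\<^sub>R N s) (at s within I)"
    and "(N has_vector_derivative (lor (B s) (B s) * \<kappa> s) *\<^sub>R T s + \<tau> s *\<^sub>R B s) (at s within I)"
    and "(B has_vector_derivative (lor (T s) (T s) * \<tau> s) *\<^sub>R N s) (at s within I)"
    and "lor (T s) (T s) \<noteq> 0" "lor (N s) (N s) \<noteq> 0" "lor (B s) (B s) \<noteq> 0" "\<kappa> s \<noteq> 0"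
    and "lor (T s) (N s) = 0" "lor (N s) (T s) = 0" "lor (T s) (B s) = 0" "lor (B s) (T s) = 0"
    and "lor (N s) (B s) = 0" "lor (B s) (N s) = 0"
    and "B s = (lor (T s) (T s) * lor (N s) (N s)) *\<^sub>R lor_cross (T s) (N s)"
    and "\<bar>lor (T s) (T s)\<bar> = 1"
proof -
  have "lor_orthonormal (T s) (N s) (B s)"
    using assms unfolding frenet_curve_def by blast
  then show "lor (T s) (T s) \<noteq> 0" "lor (N s) (N s) \<noteq> 0" "lor (B s) (B s) \<noteq> 0"
    and "lor (T s) (N s) = 0" "lor (N s) (T s) = 0" "lor (T s) (B s) = 0" "lor (B s) (T s) = 0"
    and "lor (N s) (B s) = 0" "lor (B s) (N s) = 0" "\<bar>lor (T s) (T s)\<bar> = 1"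
    by (auto simp: lor_orthonormal_def lor_commute)
qed (use assms in \<open>unfold frenet_curve_def, blast\<close>)+

text \<open>Differentiating \<open>m \<bullet> \<alpha> t = c\<close> three times shows in turn that
  \<open>m\<close> is orthogonal to \<open>T\<close>, to \<open>N\<close> (as \<kappa> is non-zero),
  and to \<open>\<tau> s *\<^sub>R B s\<close>; being non-zero, \<open>m\<close> cannot be
  orthogonal to \<open>B s\<close> as well.\<close>

lemma plane_curve_torsion_eq_0:
  assumes frenet: "frenet_curve I \<alpha> T N B \<kappa> \<tau>" and plane: "plane_curve I \<alpha>" and s: "s \<in> I"
  shows "\<tau> s = 0"
proof -
  note D = frenet_curveD[OF frenet]
  have I: "param_interval I"
    using frenet by (simp add: frenet_curve_def)
  obtain m c where m: "m \<noteq> 0" "\<And>t. t \<in> I \<Longrightarrow> m \<bullet> \<alpha> t = c"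
    using plane by (fastforce simp: plane_curve_def)
  have inner_derivative_0: "m \<bullet> f' = 0"
    if "(f has_vector_derivative f') (at t within I)" "t \<in> I" "\<And>r. r \<in> I \<Longrightarrow> m \<bullet> f r = k"
    for f f' t k
    by (rule has_vector_derivative_unique_on_param_interval[OF I that(2)
          bounded_linear.has_vector_derivative[OF bounded_linear_inner_right that(1)]
          has_vector_derivative_const that(3)])
  have T: "m \<bullet> T t = 0" if "t \<in> I" for t
    using inner_derivative_0[OF D(1)] m(2) that by blast
  have N: "m \<bullet> N t = 0" if "t \<in> I" for t
    using inner_derivative_0[OF D(2)] T D(8) that by fastforce
  have "\<tau> s * (m \<bullet> B s) = 0"
    using inner_derivative_0[OF D(3)] N T s by (fastforce simp: inner_add_right)
  moreover have "m \<bullet> B s \<noteq> 0"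
    using eq_0_if_orthogonal_to_frame[OF D(15) D(7)] T N m(1) s by blast
  ultimately show ?thesis
    by simp
qed

lemma lor_constant_on:
  assumes I: "param_interval I"
    and X: "\<And>s. s \<in> I \<Longrightarrow> (X has_vector_derivative X' s) (at s within I)"
    and Y: "\<And>s. s \<in> I \<Longrightarrow> (Y has_vector_derivative Y' s) (at s within I)"
    and 0: "\<And>s. s \<in> I \<Longrightarrow> lor (X s) (Y' s) + lor (X' s) (Y s) = 0"
  obtains c where "\<And>s. s \<in> I \<Longrightarrow> lor (X s) (Y s) = c"
proof -
  have "((\<lambda>s. lor (X s) (Y s)) has_vector_derivative 0) (at s within I)" if "s \<in> I" for s
    using lor.has_vector_derivative[OF X[OF that] Y[OF that]] 0[OF that] by simp
  moreover have "convex I"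
    using I by (simp add: param_interval_def is_interval_convex)
  ultimately show thesis
    using has_vector_derivative_zero_constant that by metis
qed

text \<open>The relation between the curves enters only through their common normal, so the lemma
  applies in both directions.\<close>

lemma helix_if_plane_bertrand_mate:
  assumes alpha: "frenet_curve I \<alpha> T N B \<kappa> \<tau>"
    and beta: "frenet_curve I \<beta> Tb Nb Bb \<kappa>b \<tau>b"
    and normal: "\<And>s. s \<in> I \<Longrightarrow> Nb s = N s"
    and nontrivial: "\<exists>s\<in>I. lor (T s) (Bb s) \<noteq> 0"
    and plane: "plane_curve I \<alpha>"
  shows "helix I \<kappa>b \<tau>b"
proof -
  note A = frenet_curveD[OF alpha] and Bt = frenet_curveD[OF beta]
  have I: "param_interval I"
    using alpha by (simp add: frenet_curve_def)
  have orth: "lor (N s) (Tb s) = 0" "lor (Tb s) (N s) = 0" "lor (N s) (Bb s) = 0"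
    "lor (Bb s) (N s) = 0" if "s \<in> I" for s
    using Bt(9,10,13,14)[OF that] normal[OF that] by simp_all
  obtain c where c: "\<And>s. s \<in> I \<Longrightarrow> lor (T s) (Tb s) = c"
    by (rule lor_constant_on[OF I A(2) Bt(2)])
      (simp_all add: A(5-14) normal orth lor.scaleR_left lor.scaleR_right)
  obtain d where d: "\<And>s. s \<in> I \<Longrightarrow> lor (T s) (Bb s) = d"
    by (rule lor_constant_on[OF I A(2) Bt(4)])
      (simp_all add: A(5-14) normal orth lor.scaleR_left lor.scaleR_right)
  \<comment> \<open>The frame signs are given pointwise; the final ratio is constant only once they
    are known not to change along the curve.\<close>
  obtain eT where eT: "\<And>s. s \<in> I \<Longrightarrow> lor (Tb s) (Tb s) = eT"
    by (rule lor_constant_on[OF I Bt(2) Bt(2)])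
      (simp_all add: Bt(5-14) normal orth lor.scaleR_left lor.scaleR_right)
  obtain eB where eB: "\<And>s. s \<in> I \<Longrightarrow> lor (Bb s) (Bb s) = eB"
    by (rule lor_constant_on[OF I Bt(4) Bt(4)])
      (simp_all add: Bt(5-14) normal orth lor.scaleR_left lor.scaleR_right)
  have d0: "d \<noteq> 0"
    using nontrivial d by auto
  have key: "eB * \<kappa>b s * eT = lor (B s) (B s) * \<kappa> s * c \<and> \<tau>b s * eB = lor (B s) (B s) * \<kappa> s * d"
    if s: "s \<in> I" for s
  proof -
    have "(lor (Bb s) (Bb s) * \<kappa>b s) *\<^sub>R Tb s + \<tau>b s *\<^sub>R Bb s
      = (lor (B s) (B s) * \<kappa> s) *\<^sub>R T s + \<tau> s *\<^sub>R B s"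
      by (rule has_vector_derivative_unique_on_param_interval[OF I s Bt(3)[OF s] A(3)[OF s] normal])
    then have eq: "(eB * \<kappa>b s) *\<^sub>R Tb s + \<tau>b s *\<^sub>R Bb s = (lor (B s) (B s) * \<kappa> s) *\<^sub>R T s"
      using plane_curve_torsion_eq_0[OF alpha plane s] eB[OF s] by simp
    show ?thesis
      using arg_cong[OF eq, of "\<lambda>x. lor x (Tb s)"] arg_cong[OF eq, of "\<lambda>x. lor x (Bb s)"]
        Bt(11,12)[OF s] eT[OF s] eB[OF s] c[OF s] d[OF s]
      by (simp add: lor.add_left lor.scaleR_left)
  qed
  have nz: "\<kappa>b s \<noteq> 0" "\<tau>b s \<noteq> 0" "eT \<noteq> 0" "eB \<noteq> 0" if s: "s \<in> I" for s
    using key[OF s] A(7,8)[OF s] Bt(5,7,8)[OF s] eT[OF s] eB[OF s] d0 by auto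
  have "\<kappa>b s / \<tau>b s = c / (eT * d)" if s: "s \<in> I" for s
  proof -
    \<comment> \<open>By \<open>key\<close>, both products equal
      \<open>lor (B s) (B s) * \<kappa> s * c * d\<close>, so the varying \<kappa> drops out of the
      ratio.\<close>
    have "eB * (\<kappa>b s * (eT * d)) = (eB * \<kappa>b s * eT) * d"
      by simp
    also have "\<dots> = (\<tau>b s * eB) * c"
      using key[OF s] by simp
    finally have "eB * (\<kappa>b s * (eT * d)) = eB * (c * \<tau>b s)"
      by (simp only: mult_ac)
    then show ?thesis
      using nz[OF s] d0 by (simp add: frac_eq_eq)
  qed
  then show ?thesis
    using nz by (auto simp: helix_def constant_on_def)
qed

text \<open>The hypothesis \<open>nontrivial\<close> excludes that \<beta> is a translate of
  \<alpha> or of its negative, in which case both curves would be plane together and have zero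
  torsion.\<close>

theorem theorem5p4:
  fixes I :: "real set"
    and \<alpha> \<beta> T N B Tb Nb Bb :: "real \<Rightarrow> real^3"
    and \<kappa> \<tau> \<kappa>b \<tau>b :: "real \<Rightarrow> real"
  assumes alpha: "frenet_curve I \<alpha> T N B \<kappa> \<tau>"
    and beta: "frenet_curve I \<beta> Tb Nb Bb \<kappa>b \<tau>b"
    and bertrand: "bertrand_direction_curve I T N B Tb Nb"
    and nontrivial: "\<exists>s\<in>I. Tb s \<noteq> T s \<and> Tb s \<noteq> - T s"
  shows "(plane_curve I \<alpha> \<longrightarrow> helix I \<kappa>b \<tau>b) \<and> (plane_curve I \<beta> \<longrightarrow> helix I \<kappa> \<tau>)"
proof -
  note A = frenet_curveD[OF alpha] and Bt = frenet_curveD[OF beta]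
  have normal: "Nb s = N s" if "s \<in> I" for s
    using bertrand that by (simp add: bertrand_direction_curve_def)
  obtain s where s: "s \<in> I" "Tb s \<noteq> T s" "Tb s \<noteq> - T s"
    using nontrivial by blast
  obtain u v w where Tb: "Tb s = u *\<^sub>R T s + v *\<^sub>R N s + w *\<^sub>R B s"
    using bertrand s(1) unfolding bertrand_direction_curve_def direction_curve_def by metis
  have "v = 0"
    using Bt(9)[OF s(1)] A(6,9,14)[OF s(1)] normal[OF s(1)]
    by (simp add: Tb lor.add_left lor.scaleR_left)
  \<comment> \<open>Otherwise \<open>Tb s\<close> is a multiple of \<open>T s\<close>, and unit
    speed of both curves makes the factor 1 or -1.\<close>
  have TbB: "lor (Tb s) (B s) \<noteq> 0"
  proof
    assume "lor (Tb s) (B s) = 0"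
    then have "w = 0"
      using A(7,11,13)[OF s(1)] by (simp add: Tb lor.add_left lor.scaleR_left)
    then have "Tb s = u *\<^sub>R T s"
      using Tb \<open>v = 0\<close> by simp
    moreover have "\<bar>lor (Tb s) (Tb s)\<bar> = 1" "\<bar>lor (T s) (T s)\<bar> = 1"
      using A(16) Bt(16) s(1) by blast+
    ultimately have "\<bar>u * u\<bar> = 1"
      by (simp add: lor.scaleR_left lor.scaleR_right abs_mult del: abs_mult_self_eq)
    then have "u = 1 \<or> u = -1"
      by (simp add: square_eq_1_iff)
    then show False
      using \<open>Tb s = u *\<^sub>R T s\<close> s(2,3) by auto
  qed
  \<comment> \<open>Each binormal is, up to sign, the cross product of its tangent with the common
    normal, so one triple product links the non-vanishing conditions for the two directions.\<close>
  then have "lor (Tb s) (lor_cross (T s) (N s)) \<noteq> 0"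
    by (subst (asm) A(15)[OF s(1)]) (simp add: lor.scaleR_right)
  then have "lor (T s) (lor_cross (Tb s) (Nb s)) \<noteq> 0"
    using lor_cross_triple[of "Tb s" "T s"] normal[OF s(1)] by simp
  then have "lor (T s) (Bb s) \<noteq> 0"
    using Bt(5,6)[OF s(1)] by (subst Bt(15)[OF s(1)]) (simp add: lor.scaleR_right)
  then show ?thesis
    using helix_if_plane_bertrand_mate[OF alpha beta normal]
      helix_if_plane_bertrand_mate[OF beta alpha normal[symmetric]] TbB s(1) by blast
qed

end
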